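(* Consider the optimization algorithm $$\Sigma_t=O(\Lambda_t),\qquad \Lambda_{t+1}=\Pi_{\mathbb{S}_1\cap\mathbb{S}_2}\big[\Lambda_t+\delta\Sigma_t\big],\qquad \overline{\Lambda}_t=\tfrac{t-1}{t}\overline{\Lambda}_{t-1}+\tfrac1t\Lambda_t,\qquad \overline{\Sigma}_t=O(\overline{\Lambda}_t),$$ where $\mathbb{S}_1=\{\Lambda:\mathrm{Diag}(\Lambda)\le0\}$ and $\mathbb{S}_2=\{\Lambda: I-\Lambda\in\mathbb{S}_+\}$ are the conic constraint sets of $\Lambda$ in the max-min problem $$\max_{\Lambda\in\mathbb{S}_1\cap\mathbb{S}_2}\ \min_{\Sigma\in\mathbb{B}_{\varepsilon}^{\mathrm d}(\widehat\Sigma)}\ \langle\Lambda,\Sigma\rangle ,$$ $\delta$ is a constant stepsize, and $O$ is the linear minimization oracle over $\mathbb{B}_{\varepsilon}^{\mathrm d}(\widehat\Sigma)$. Starting from any symmetric initial condition $\Lambda_1$, after $T$ iterations we have $$0\le\langle\Lambda^\star,\Sigma^\star\rangle-\langle\overline\Lambda_T,\overline\Sigma_T\rangle\ \le\ \frac{\|\Lambda_1-\Lambda^\star\|^2}{2\delta T}+\frac{\delta}{2}\mathcal{L}^2,$$ where $(\Lambda^\star,\Sigma^\star)$ is a saddle point solution of the max-min problem and $\mathcal{L}\coloneqq\max_{\Sigma\in\mathbb{B}_{\varepsilon}^{\mathrm d}(\widehat\Sigma)}\|\Sigma\|_F$, which is a Lipschitz constant with respect to $\|\cdot\|_F$ of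 the dual function $g(\Lambda)=\min_{\Sigma\in\mathbb{B}_{\varepsilon}^{\mathrm d}(\widehat\Sigma)}\langle\Lambda,\Sigma\rangle$.
   Context: All matrices are real symmetric $n\times n$. $\mathbb{S}_+$ is the cone of positive semidefinite matrices, $\langle A,B\rangle=\operatorname{Tr}(A^\top B)$, $\|\cdot\|_F$ is the Frobenius norm, and the norm $\|\cdot\|$ in the error bound is also the Frobenius norm. $\mathrm{Diag}(A)$ is the diagonal matrix containing the diagonal entries of $A$, and $\mathrm{Diag}(A)\le0$ means that these entries are non-positive. $\widehat\Sigma$ is a given empirical covariance matrix, $\mathrm d$ is a generic distance function on matrices, and $\mathbb{B}_{\varepsilon}^{\mathrm d}(\widehat\Sigma)=\{\Sigma\succeq 0:\mathrm d(\Sigma,\widehat\Sigma)\le\varepsilon\}$ is the ball of radius $\varepsilon$. The linear minimization oracle assigns to each symmetric $\Lambda$ an element $O(\Lambda)\in\arg\min_{\Sigma}\{\langle\Lambda,\Sigma\rangle:\Sigma\in\mathbb{B}_{\varepsilon}^{\mathrm d}(\widehat\Sigma)\}$ (an arbitrary selection if there are several optimizers). $\Pi_{\mathbb{A}}[x]=\arg\min_{y\in\mathbb{A}}\|x-y\|_F^2$ is the orthogonal projection.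
   Formalization: The lower bound 0 ≤ gap is claimed only when Λ₁ lies in S₁∩S₂, as it fails for some infeasible symmetric Λ₁ (ball {I}, δ=1, Λ₁=I gives gap −n/T); the upper bound and Lipschitz claim hold for any symmetric Λ₁. The stepsize δ is taken positive. *)

theory Defs
  imports "HOL-Analysis.Analysis"
begin

definition sym_mats :: "(real^'n^'n) set" where
  "sym_mats = {A. transpose A = A}"

definition psd_cone :: "(real^'n^'n) set" where
  "psd_cone = {A \<in> sym_mats. \<forall>x. 0 \<le> x \<bullet> (A *v x)}"

definition frob_inner :: "real^'n^'n \<Rightarrow> real^'n^'n \<Rightarrow> real" where
  "frob_inner A B = trace (transpose A ** B)"

text \<open>The library's inner product and norm on the type of matrices (a vector of rows)
  are the trace inner product and the Frobenius norm, so \<open>norm\<close>, \<open>closest_point\<close> and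
  \<open>lipschitz_on\<close> below all refer to the Frobenius geometry.\<close>

lemma frob_inner_eq_inner: "frob_inner A B = A \<bullet> B"
  unfolding frob_inner_def trace_def transpose_def matrix_matrix_mult_def inner_vec_def
  by simp (rule sum.swap)

lemma norm_eq_frobenius: "norm A = sqrt (frob_inner A A)"
  by (simp add: frob_inner_eq_inner norm_eq_sqrt_inner)

definition cone_S1 :: "(real^'n^'n) set" where
  "cone_S1 = {A \<in> sym_mats. \<forall>i. A $ i $ i \<le> 0}"

definition cone_S2 :: "(real^'n^'n) set" where
  "cone_S2 = {A \<in> sym_mats. mat 1 - A \<in> psd_cone}"

text \<open>The ball of radius \<open>\<epsilon>\<close>. The distance function is arbitrary: it need not be a metric, and it
  may take the value \<open>\<infinity>\<close>, as the Kullback-Leibler divergence does at singular matrices.\<close>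

definition dball ::
  "(real^'n^'n \<Rightarrow> real^'n^'n \<Rightarrow> ereal) \<Rightarrow> real \<Rightarrow> real^'n^'n \<Rightarrow> (real^'n^'n) set" where
  "dball d \<epsilon> C = {S \<in> psd_cone. d S C \<le> ereal \<epsilon>}"

definition is_lmo :: "(real^'n^'n) set \<Rightarrow> (real^'n^'n \<Rightarrow> real^'n^'n) \<Rightarrow> bool" where
  "is_lmo B orc \<longleftrightarrow>
     (\<forall>L \<in> sym_mats. is_arg_min (\<lambda>S. frob_inner L S) (\<lambda>S. S \<in> B) (orc L))"

definition dual_fun :: "(real^'n^'n) set \<Rightarrow> real^'n^'n \<Rightarrow> real" where
  "dual_fun B L = (INF S\<in>B. frob_inner L S)"

definition max_norm :: "(real^'n^'n) set \<Rightarrow> real" where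
  "max_norm B = (SUP S\<in>B. norm S)"

definition is_saddle_point :: "'a set \<Rightarrow> 'b set \<Rightarrow> ('a \<Rightarrow> 'b \<Rightarrow> real) \<Rightarrow> 'a \<Rightarrow> 'b \<Rightarrow> bool" where
  "is_saddle_point X Y f x y \<longleftrightarrow> x \<in> X \<and> y \<in> Y \<and>
     (\<forall>x'\<in>X. f x' y \<le> f x y) \<and> (\<forall>y'\<in>Y. f x y \<le> f x y')"

text \<open>Existence of a linear minimization oracle makes the infimum in \<open>dual_fun\<close> a minimum and the
  supremum in \<open>max_norm\<close> a maximum, so neither has a junk value.\<close>

lemma dual_fun_attained:
  assumes "is_lmo B orc" "L \<in> sym_mats"
  shows "orc L \<in> B" "dual_fun B L = frob_inner L (orc L)"
    "\<And>S. S \<in> B \<Longrightarrow> dual_fun B L \<le> frob_inner L S"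
proof -
  have *: "orc L \<in> B" "\<And>S. S \<in> B \<Longrightarrow> frob_inner L (orc L) \<le> frob_inner L S"
    using assms by (auto simp: is_lmo_def is_arg_min_linorder)
  show "orc L \<in> B" by fact
  show eq: "dual_fun B L = frob_inner L (orc L)"
    unfolding dual_fun_def using * by (intro cInf_eq_minimum) auto
  show "dual_fun B L \<le> frob_inner L S" if "S \<in> B" for S
    using * that eq by simp
qed

lemma max_norm_attained:
  assumes lmo: "is_lmo B orc" and sym: "B \<subseteq> sym_mats"
  shows "\<exists>S\<in>B. norm S = max_norm B" "\<And>S. S \<in> B \<Longrightarrow> norm S \<le> max_norm B"
proof -
  have ne: "B \<noteq> {}"
    using dual_fun_attained(1)[OF lmo, of 0] by (auto simp: sym_mats_def transpose_def vec_eq_iff)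
  have bd_dir: "\<exists>c. \<forall>S\<in>B. \<bar>L \<bullet> S\<bar> \<le> c" if "L \<in> sym_mats" for L
  proof -
    have L': "- L \<in> sym_mats" using that by (auto simp: sym_mats_def transpose_def vec_eq_iff)
    have "\<bar>L \<bullet> S\<bar> \<le> \<bar>dual_fun B L\<bar> + \<bar>dual_fun B (- L)\<bar>" if "S \<in> B" for S
      using dual_fun_attained(3)[OF lmo \<open>L \<in> sym_mats\<close> that] dual_fun_attained(3)[OF lmo L' that]
      by (simp add: frob_inner_eq_inner)
    then show ?thesis by blast
  qed
  have entry: "\<exists>c. \<forall>S\<in>B. \<bar>S $ i $ j\<bar> \<le> c" for i j
  proof -
    define L :: "real^'a^'a" where "L = axis i (axis j 1) + axis j (axis i 1)"
    have "L \<in> sym_mats"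
      by (auto simp: L_def sym_mats_def transpose_def vec_eq_iff axis_def)
    then obtain c where c: "\<And>S. S \<in> B \<Longrightarrow> \<bar>L \<bullet> S\<bar> \<le> c" using bd_dir by blast
    have "\<bar>S $ i $ j\<bar> \<le> c" if "S \<in> B" for S
    proof -
      have "S $ j $ i = S $ i $ j"
        using sym that by (auto simp: sym_mats_def transpose_def vec_eq_iff)
      then have "L \<bullet> S = 2 * S $ i $ j"
        by (simp add: L_def inner_add_left inner_axis')
      then show ?thesis using c[OF that] by linarith
    qed
    then show ?thesis by blast
  qed
  then obtain c where c: "\<And>i j S. S \<in> B \<Longrightarrow> \<bar>S $ i $ j\<bar> \<le> c i j" by metis
  have "norm S \<le> (\<Sum>i\<in>UNIV. \<Sum>j\<in>UNIV. c i j)" if "S \<in> B" for S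
  proof -
    have "norm S \<le> (\<Sum>i\<in>UNIV. norm (S $ i))"
      unfolding norm_vec_def by (rule L2_set_le_sum) auto
    also have "\<dots> \<le> (\<Sum>i\<in>UNIV. \<Sum>j\<in>UNIV. \<bar>S $ i $ j\<bar>)"
      by (intro sum_mono norm_le_l1_cart)
    also have "\<dots> \<le> (\<Sum>i\<in>UNIV. \<Sum>j\<in>UNIV. c i j)"
      by (intro sum_mono c that)
    finally show ?thesis .
  qed
  then have bdd: "bdd_above (norm ` B)" and bnd: "bounded B"
    by (auto simp: bdd_above_def bounded_iff)
  show le: "norm S \<le> max_norm B" if "S \<in> B" for S
    unfolding max_norm_def using bdd that by (rule cSUP_upper2) auto
  have "compact (closure B)" using bnd by (simp add: compact_closure)
  then obtain S0 where S0: "S0 \<in> closure B" "\<And>S. S \<in> closure B \<Longrightarrow> norm S \<le> norm S0"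
    using continuous_attains_sup[of "closure B" norm] ne continuous_on_norm_id by auto
  have "closed (sym_mats :: (real^'a^'a) set)"
    unfolding sym_mats_def transpose_def vec_eq_iff
    by (auto intro!: closed_Collect_all closed_Collect_eq continuous_intros)
  then have S0sym: "- S0 \<in> sym_mats"
    using S0(1) sym closure_minimal[of B sym_mats]
    by (auto simp: sym_mats_def transpose_def vec_eq_iff)
  let ?S = "orc (- S0)"
  have SB: "?S \<in> B" using dual_fun_attained(1)[OF lmo S0sym] .
  have "B \<subseteq> {S. S0 \<bullet> S \<le> S0 \<bullet> ?S}"
    using dual_fun_attained(2,3)[OF lmo S0sym] by (auto simp: frob_inner_eq_inner)
  moreover have "closed {S. S0 \<bullet> S \<le> S0 \<bullet> ?S}" by (rule closed_halfspace_le)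
  ultimately have "S0 \<bullet> S0 \<le> S0 \<bullet> ?S" using S0(1) closure_minimal by blast
  also have "\<dots> \<le> norm S0 * norm ?S" by (rule norm_cauchy_schwarz)
  finally have "norm S0 * norm S0 \<le> norm S0 * norm ?S"
    by (simp add: norm_eq_sqrt_inner flip: power2_eq_square)
  then have "norm S0 \<le> norm ?S"
    by (cases "S0 = 0") (auto dest: mult_left_le_imp_le)
  then have ub: "norm S \<le> norm ?S" if "S \<in> B" for S
    using S0(2) that closure_subset by (meson in_mono order_trans)
  have "max_norm B = norm ?S"
    unfolding max_norm_def using SB ub by (intro cSup_eq_maximum) auto
  then show "\<exists>S\<in>B. norm S = max_norm B" using SB by metis
qed

end

theory Submission
  imports Defs
begin

text \<open>
  The algorithm is projected supergradient ascent, run on the concave dual function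
  \<open>g(\<Lambda>) = min\<^sub>S \<langle>\<Lambda>, S\<rangle>\<close>: a minimizer \<open>S\<close> of \<open>\<langle>\<Lambda>, \<cdot>\<rangle>\<close> over the ball is a supergradient of \<open>g\<close> at
  \<open>\<Lambda>\<close>, and every point of the ball has norm at most \<open>max_norm\<close>. Both the rate and the Lipschitz bound
  come from this.

  Rate. Projection onto \<open>S\<^sub>1 \<inter> S\<^sub>2\<close> does not increase the distance to its member \<open>\<Lambda>\<^sup>\<star>\<close>, so
  expanding the square of one step bounds the linearized gap \<open>\<langle>\<Lambda>\<^sup>\<star> - \<Lambda>\<^sub>t, \<Sigma>\<^sub>t\<rangle>\<close> by the decrease of the
  squared distance plus a term of order \<open>\<delta>\<^sup>2\<close>; these telescope (\<open>projected_ascent_regret\<close>). The saddle value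
  is at most \<open>\<langle>\<Lambda>\<^sup>\<star>, \<Sigma>\<^sub>t\<rangle>\<close>, hence the sum of the linearized gaps dominates the sum of
  \<open>\<langle>\<Lambda>\<^sup>\<star>, \<Sigma>\<^sup>\<star>\<rangle> - g(\<Lambda>\<^sub>t)\<close>, and by concavity the gap of the average iterate is no larger than the mean
  of these (\<open>dual_fun_average\<close>). The first iterate enters only through its distance to \<open>\<Lambda>\<^sup>\<star>\<close>, so it
  may be infeasible.

  Sign. If the first iterate is feasible, then so are all iterates and, by convexity, their average;
  then weak duality \<open>g(\<Lambda>) \<le> \<langle>\<Lambda>, \<Sigma>\<^sup>\<star>\<rangle> \<le> \<langle>\<Lambda>\<^sup>\<star>, \<Sigma>\<^sup>\<star>\<rangle>\<close> applies to it.
\<close>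

section \<open>Projected ascent and running averages\<close>

text \<open>
  The left-hand side is the regret of the ascent on the linear rewards \<open>g t\<close> against the fixed
  comparator \<open>u\<close>. Nonexpansiveness of the projection gives
  \<open>\<parallel>x\<^sub>t\<^sub>+\<^sub>1 - u\<parallel>\<^sup>2 \<le> \<parallel>x\<^sub>t + \<delta> g\<^sub>t - u\<parallel>\<^sup>2\<close>, and the resulting one-step bounds telescope.
\<close>

lemma projected_ascent_regret:
  fixes x g :: "nat \<Rightarrow> 'a::euclidean_space"
  assumes K: "closed K" "convex K" and u: "u \<in> K" and \<delta>: "\<delta> > 0"
    and step: "\<And>t. t \<ge> 1 \<Longrightarrow> x (t + 1) = closest_point K (x t + \<delta> *\<^sub>R g t)"
    and bound: "\<And>t. t \<ge> 1 \<Longrightarrow> norm (g t) \<le> L"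
  shows "(\<Sum>t=1..T. (u - x t) \<bullet> g t) \<le> (norm (x 1 - u))\<^sup>2 / (2 * \<delta>) + real T * (\<delta> / 2 * L\<^sup>2)"
proof -
  have one_step: "2 * \<delta> * ((u - x t) \<bullet> g t) \<le>
      (norm (x t - u))\<^sup>2 - (norm (x (t + 1) - u))\<^sup>2 + \<delta>\<^sup>2 * L\<^sup>2" if t: "t \<ge> 1" for t
  proof -
    have "dist (closest_point K (x t + \<delta> *\<^sub>R g t)) (closest_point K u) \<le> dist (x t + \<delta> *\<^sub>R g t) u"
      using K u by (intro closest_point_lipschitz) auto
    then have "norm (x (t + 1) - u) \<le> norm ((x t - u) + \<delta> *\<^sub>R g t)"
      using closest_point_self[OF u] step[OF t] by (simp add: dist_norm algebra_simps)
    then have "(norm (x (t + 1) - u))\<^sup>2 \<le> (norm ((x t - u) + \<delta> *\<^sub>R g t))\<^sup>2"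
      by (intro power_mono) auto
    also have "\<dots> = (norm (x t - u))\<^sup>2 - 2 * \<delta> * ((u - x t) \<bullet> g t) + \<delta>\<^sup>2 * (norm (g t))\<^sup>2"
      unfolding power2_norm_eq_inner
      by (simp add: inner_add_left inner_add_right inner_diff_left inner_diff_right
          inner_commute[of "g t" u] inner_commute[of "g t" "x t"]
          power2_eq_square algebra_simps)
    also have "\<delta>\<^sup>2 * (norm (g t))\<^sup>2 \<le> \<delta>\<^sup>2 * L\<^sup>2"
      using bound[OF t] by (intro mult_left_mono power_mono) auto
    finally show ?thesis by simp
  qed
  have "2 * \<delta> * (\<Sum>t=1..T. (u - x t) \<bullet> g t) \<le>
      (norm (x 1 - u))\<^sup>2 - (norm (x (T + 1) - u))\<^sup>2 + real T * (\<delta>\<^sup>2 * L\<^sup>2)"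
  proof (induction T)
    case (Suc T)
    then show ?case
      using one_step[of "Suc T"] by (simp add: algebra_simps)
  qed simp
  also have "\<dots> \<le> (norm (x 1 - u))\<^sup>2 + real T * (\<delta>\<^sup>2 * L\<^sup>2)" by simp
  finally show ?thesis
    using \<delta> by (simp add: field_simps power2_eq_square)
qed

text \<open>
  The recursion multiplies the value at index \<open>0\<close> by zero, so the average starts at \<open>x 1\<close>.
\<close>

lemma running_average:
  fixes x a :: "nat \<Rightarrow> 'a::real_vector"
  assumes rec: "\<And>t. t \<ge> 1 \<Longrightarrow>
      a t = ((real t - 1) / real t) *\<^sub>R a (t - 1) + (1 / real t) *\<^sub>R x t"
    and T: "T \<ge> 1"
  shows "a T = (1 / real T) *\<^sub>R (\<Sum>t=1..T. x t)"
proof -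
  have "(\<Sum>t=1..T. x t) = real T *\<^sub>R a T"
  proof (induction T)
    case (Suc T)
    then show ?case
      using rec[of "Suc T"] by (simp add: scaleR_add_right)
  qed simp
  then show ?thesis using T by simp
qed

lemma convex_average:
  assumes "convex S" "T \<ge> 1" "\<And>t. t \<in> {1..T} \<Longrightarrow> x t \<in> S"
  shows "(1 / real T) *\<^sub>R (\<Sum>t=1..T. x t) \<in> S"
  using convex_sum[OF _ assms(1), of "{1..T}" "\<lambda>_. 1 / real T" x] assms(2,3)
  by (simp add: scaleR_right.sum)

section \<open>The feasible set\<close>

lemma subspace_sym_mats: "subspace (sym_mats :: (real^'n^'n) set)"
  by (auto simp: subspace_def sym_mats_def transpose_def vec_eq_iff)

lemma
  shows convex_psd_cone: "convex (psd_cone :: (real^'n^'n) set)"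
    and closed_psd_cone: "closed (psd_cone :: (real^'n^'n) set)"
proof -
  have eq: "(psd_cone :: (real^'n^'n) set) = sym_mats \<inter> (\<Inter>x. {A. 0 \<le> x \<bullet> (A *v x)})"
    by (auto simp: psd_cone_def)
  have lin: "linear (\<lambda>A::real^'n^'n. x \<bullet> (A *v x))" for x
    by (rule linearI) (auto simp: matrix_vector_mult_add_rdistrib inner_add_right
        scaleR_matrix_vector_assoc[symmetric])
  have "convex ((\<lambda>A::real^'n^'n. x \<bullet> (A *v x)) -` {0..})" for x
    by (intro convex_linear_vimage lin) auto
  then have "convex {A::real^'n^'n. 0 \<le> x \<bullet> (A *v x)}" for x
    by (simp add: vimage_def)
  then show "convex (psd_cone :: (real^'n^'n) set)"
    unfolding eq by (intro convex_Int convex_INT subspace_imp_convex[OF subspace_sym_mats])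
  have "closed {A::real^'n^'n. 0 \<le> x \<bullet> (A *v x)}" for x
    by (intro closed_Collect_le continuous_on_const linear_continuous_on
        linear_conv_bounded_linear[THEN iffD1] lin)
  then show "closed (psd_cone :: (real^'n^'n) set)"
    unfolding eq by (intro closed_Int closed_INT ballI closed_subspace[OF subspace_sym_mats])
qed

lemma
  shows convex_cone_S1: "convex (cone_S1 :: (real^'n^'n) set)"
    and closed_cone_S1: "closed (cone_S1 :: (real^'n^'n) set)"
proof -
  have eq: "(cone_S1 :: (real^'n^'n) set) = sym_mats \<inter> (\<Inter>i. {A. axis i (axis i 1) \<bullet> A \<le> 0})"
    by (auto simp: cone_S1_def inner_axis')
  show "convex (cone_S1 :: (real^'n^'n) set)"
    unfolding eq by (intro convex_Int convex_INT convex_halfspace_le subspace_imp_convex subspace_sym_mats)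
  show "closed (cone_S1 :: (real^'n^'n) set)"
    unfolding eq by (intro closed_Int closed_INT ballI closed_halfspace_le closed_subspace subspace_sym_mats)
qed

lemma
  shows convex_cone_S2: "convex (cone_S2 :: (real^'n^'n) set)"
    and closed_cone_S2: "closed (cone_S2 :: (real^'n^'n) set)"
proof -
  have I: "(mat 1 :: real^'n^'n) \<in> sym_mats"
    by (simp add: sym_mats_def)
  have "A \<in> sym_mats" if "mat 1 - A \<in> sym_mats" for A :: "real^'n^'n"
    using subspace_diff[OF subspace_sym_mats I that] by simp
  then have "(cone_S2 :: (real^'n^'n) set) = {A. mat 1 - A \<in> psd_cone}"
    by (auto simp: cone_S2_def psd_cone_def)
  also have "\<dots> = (\<lambda>A. mat 1 - A) ` psd_cone"
    by (auto intro: image_eqI[of _ _ "mat 1 - _"])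
  finally have eq: "(cone_S2 :: (real^'n^'n) set) = (\<lambda>A. mat 1 - A) ` psd_cone" .
  show "convex (cone_S2 :: (real^'n^'n) set)"
    unfolding eq using convex_translation[OF convex_negations[OF convex_psd_cone], of "mat 1"]
    by (simp add: image_image)
  show "closed (cone_S2 :: (real^'n^'n) set)"
    unfolding eq using closed_translation[OF closed_negations[OF closed_psd_cone], of "mat 1"]
    by (simp add: image_image)
qed

section \<open>The dual function\<close>

text \<open>
  Concavity of the dual function, for equal weights: at a minimizer for the average, each term of
  the average is at least the dual value of its own argument.
\<close>

lemma dual_fun_average:
  assumes lmo: "is_lmo B orc" and sym: "\<And>t. t \<in> {1..T} \<Longrightarrow> x t \<in> sym_mats" and T: "T \<ge> 1"
  shows "(\<Sum>t=1..T. dual_fun B (x t)) \<le> real T * dual_fun B ((1 / real T) *\<^sub>R (\<Sum>t=1..T. x t))"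
proof -
  let ?a = "(1 / real T) *\<^sub>R (\<Sum>t=1..T. x t)"
  have a: "?a \<in> sym_mats"
    by (intro convex_average subspace_imp_convex subspace_sym_mats T sym)
  have "(\<Sum>t=1..T. dual_fun B (x t)) \<le> (\<Sum>t=1..T. x t \<bullet> orc ?a)"
    using dual_fun_attained(3)[OF lmo sym dual_fun_attained(1)[OF lmo a]]
    by (intro sum_mono) (simp add: frob_inner_eq_inner)
  also have "\<dots> = real T * (?a \<bullet> orc ?a)"
    using T by (simp add: inner_sum_left)
  also have "?a \<bullet> orc ?a = dual_fun B ?a"
    using dual_fun_attained(2)[OF lmo a] by (simp add: frob_inner_eq_inner)
  finally show ?thesis .
qed

text \<open>
  The minimizer for \<open>M\<close> is a supergradient at \<open>M\<close>, so \<open>g(L) - g(M) \<le> \<langle>L - M, orc M\<rangle>\<close>;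
  exchanging \<open>L\<close> and \<open>M\<close> bounds the absolute value.
\<close>

lemma dual_fun_lipschitz:
  assumes lmo: "is_lmo B orc" and B: "B \<subseteq> sym_mats"
  shows "(max_norm B)-lipschitz_on sym_mats (dual_fun B)"
proof (rule lipschitz_onI)
  obtain S where "S \<in> B" "norm S = max_norm B" using max_norm_attained(1)[OF lmo B] by blast
  then show "0 \<le> max_norm B" by (metis norm_ge_zero)
next
  have one_sided: "dual_fun B L - dual_fun B M \<le> max_norm B * dist L M"
    if L: "L \<in> sym_mats" and M: "M \<in> sym_mats" for L M
  proof -
    have oB: "orc M \<in> B" by (rule dual_fun_attained(1)[OF lmo M])
    have "dual_fun B L - dual_fun B M \<le> (L - M) \<bullet> orc M"
      using dual_fun_attained(2)[OF lmo M] dual_fun_attained(3)[OF lmo L oB]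
      by (simp add: frob_inner_eq_inner inner_diff_left)
    also have "\<dots> \<le> norm (L - M) * norm (orc M)" by (rule norm_cauchy_schwarz)
    also have "\<dots> \<le> norm (L - M) * max_norm B"
      by (intro mult_left_mono max_norm_attained(2)[OF lmo B oB]) simp
    finally show ?thesis by (simp add: dist_norm mult.commute)
  qed
  fix L M :: "real^'a^'a"
  assume "L \<in> sym_mats" "M \<in> sym_mats"
  then show "dist (dual_fun B L) (dual_fun B M) \<le> max_norm B * dist L M"
    using one_sided[of L M] one_sided[of M L] by (simp add: dist_real_def dist_commute abs_le_iff)
qed

section \<open>The convergence rate\<close>

theorem proposition2p3:
  fixes d :: "real^'n^'n \<Rightarrow> real^'n^'n \<Rightarrow> ereal"
    and \<Sigma>hat \<Lambda>star \<Sigma>star :: "real^'n^'n"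
    and \<epsilon> \<delta> :: real
    and orc :: "real^'n^'n \<Rightarrow> real^'n^'n"
    and \<Lambda> \<Sigma> \<Lambda>bar \<Sigma>bar :: "nat \<Rightarrow> real^'n^'n"
    and T :: nat
  defines "\<B> \<equiv> dball d \<epsilon> \<Sigma>hat"
  assumes "\<Sigma>hat \<in> psd_cone"
    and "\<delta> > 0"
    and "is_lmo \<B> orc"
    and "\<Lambda> 1 \<in> sym_mats"
    and "\<And>t. t \<ge> 1 \<Longrightarrow> \<Sigma> t = orc (\<Lambda> t)"
    and "\<And>t. t \<ge> 1 \<Longrightarrow> \<Lambda> (t + 1) = closest_point (cone_S1 \<inter> cone_S2) (\<Lambda> t + \<delta> *\<^sub>R \<Sigma> t)"
    and "\<And>t. t \<ge> 1 \<Longrightarrow>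
           \<Lambda>bar t = ((real t - 1) / real t) *\<^sub>R \<Lambda>bar (t - 1) + (1 / real t) *\<^sub>R \<Lambda> t"
    and "\<And>t. t \<ge> 1 \<Longrightarrow> \<Sigma>bar t = orc (\<Lambda>bar t)"
    and "is_saddle_point (cone_S1 \<inter> cone_S2) \<B> frob_inner \<Lambda>star \<Sigma>star"
    and "T \<ge> 1"
  shows "(\<Lambda> 1 \<in> cone_S1 \<inter> cone_S2 \<longrightarrow>
            0 \<le> frob_inner \<Lambda>star \<Sigma>star - frob_inner (\<Lambda>bar T) (\<Sigma>bar T)) \<and>
         frob_inner \<Lambda>star \<Sigma>star - frob_inner (\<Lambda>bar T) (\<Sigma>bar T)
           \<le> (norm (\<Lambda> 1 - \<Lambda>star))\<^sup>2 / (2 * \<delta> * real T) + \<delta> / 2 * (max_norm \<B>)\<^sup>2 \<and>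
         (max_norm \<B>)-lipschitz_on sym_mats (dual_fun \<B>)"
proof -
  let ?K = "cone_S1 \<inter> cone_S2 :: (real^'n^'n) set"
  note lmo = \<open>is_lmo \<B> orc\<close> and step = assms(7)
  have B: "\<B> \<subseteq> sym_mats" by (auto simp: \<B>_def dball_def psd_cone_def)
  have K: "closed ?K" "convex ?K"
    by (intro closed_Int closed_cone_S1 closed_cone_S2 convex_Int convex_cone_S1 convex_cone_S2)+
  have K_sym: "?K \<subseteq> sym_mats" by (auto simp: cone_S1_def)
  have star: "\<Lambda>star \<in> ?K" "\<Sigma>star \<in> \<B>"
    and star_max: "\<And>L. L \<in> ?K \<Longrightarrow> frob_inner L \<Sigma>star \<le> frob_inner \<Lambda>star \<Sigma>star"
    and star_min: "\<And>S. S \<in> \<B> \<Longrightarrow> frob_inner \<Lambda>star \<Sigma>star \<le> frob_inner \<Lambda>star S"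
    using assms(10) by (auto simp: is_saddle_point_def)
  have feasible: "\<Lambda> t \<in> ?K" if "t \<ge> 2" for t
    using step[of "t - 1"] that closest_point_in_set[OF K(1), of "\<Lambda> (t - 1) + \<delta> *\<^sub>R \<Sigma> (t - 1)"] star
    by auto
  have \<Lambda>_sym: "\<Lambda> t \<in> sym_mats" if "t \<ge> 1" for t
    using feasible[of t] K_sym assms(5) that by (cases "t = 1") auto
  have avg: "\<Lambda>bar T = (1 / real T) *\<^sub>R (\<Sum>t=1..T. \<Lambda> t)"
    using assms(8,11) by (rule running_average)
  have avg_sym: "\<Lambda>bar T \<in> sym_mats"
    unfolding avg
    by (intro convex_average subspace_imp_convex subspace_sym_mats \<open>T \<ge> 1\<close> \<Lambda>_sym) simp
  have oracle_value: "frob_inner (\<Lambda>bar T) (\<Sigma>bar T) = dual_fun \<B> (\<Lambda>bar T)"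
    using dual_fun_attained(2)[OF lmo avg_sym] assms(9)[OF \<open>T \<ge> 1\<close>] by simp

  have "0 \<le> frob_inner \<Lambda>star \<Sigma>star - frob_inner (\<Lambda>bar T) (\<Sigma>bar T)" if init: "\<Lambda> 1 \<in> ?K"
  proof -
    have "\<Lambda> t \<in> ?K" if "t \<ge> 1" for t
      using feasible[of t] init that by (cases "t = 1") auto
    then have "\<Lambda>bar T \<in> ?K"
      unfolding avg by (intro convex_average K \<open>T \<ge> 1\<close>) simp
    then show ?thesis
      using star_max[of "\<Lambda>bar T"] dual_fun_attained(3)[OF lmo avg_sym star(2)] oracle_value by simp
  qed
  moreover
  have "frob_inner \<Lambda>star \<Sigma>star - frob_inner (\<Lambda>bar T) (\<Sigma>bar T)
      \<le> (norm (\<Lambda> 1 - \<Lambda>star))\<^sup>2 / (2 * \<delta> * real T) + \<delta> / 2 * (max_norm \<B>)\<^sup>2"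
  proof -
    have \<Sigma>_in: "\<Sigma> t \<in> \<B>" if "t \<ge> 1" for t
      using dual_fun_attained(1)[OF lmo \<Lambda>_sym[OF that]] assms(6)[OF that] by simp
    have gap: "frob_inner \<Lambda>star \<Sigma>star - dual_fun \<B> (\<Lambda> t) \<le> (\<Lambda>star - \<Lambda> t) \<bullet> \<Sigma> t" if "t \<ge> 1" for t
      using star_min[OF \<Sigma>_in[OF that]] dual_fun_attained(2)[OF lmo \<Lambda>_sym[OF that]] assms(6)[OF that]
      by (simp add: frob_inner_eq_inner inner_diff_left)
    have "real T * (frob_inner \<Lambda>star \<Sigma>star - dual_fun \<B> (\<Lambda>bar T))
        \<le> (\<Sum>t=1..T. frob_inner \<Lambda>star \<Sigma>star - dual_fun \<B> (\<Lambda> t))"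
      using dual_fun_average[OF lmo \<Lambda>_sym \<open>T \<ge> 1\<close>]
      by (simp add: avg sum_subtractf right_diff_distrib)
    also have "\<dots> \<le> (\<Sum>t=1..T. (\<Lambda>star - \<Lambda> t) \<bullet> \<Sigma> t)"
      by (intro sum_mono gap) simp
    also have "\<dots> \<le> (norm (\<Lambda> 1 - \<Lambda>star))\<^sup>2 / (2 * \<delta>) + real T * (\<delta> / 2 * (max_norm \<B>)\<^sup>2)"
      by (rule projected_ascent_regret[where x = \<Lambda> and g = \<Sigma>, OF K star(1) \<open>\<delta> > 0\<close> step])
        (use max_norm_attained(2)[OF lmo B] \<Sigma>_in in auto)
    finally show ?thesis
      using \<open>T \<ge> 1\<close> \<open>\<delta> > 0\<close> by (simp add: oracle_value field_simps)
  qed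
  moreover have "(max_norm \<B>)-lipschitz_on sym_mats (dual_fun \<B>)"
    by (rule dual_fun_lipschitz[OF lmo B])
  ultimately show ?thesis by blast
qed

end
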